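(* Let $\mathrm{Inf}$ be an influence function with sensitivity $\Delta_{\mathrm{Inf}}$, $\mathcal P$ a finite set of explanation predicates, $\rho_{Topk}>0$ a privacy parameter and $k$ an integer with $1\le k\le|\mathcal P|$. Then: (1) the One-shot Top-k mechanism outputs $k$ explanation predicates and satisfies $\rho_{Topk}$-zCDP; (2) for a database $D$, let $OPT^{(i)}$ be the $i$-th highest (true) influence among the predicates of $\mathcal P$ and let $\mathcal M^{(i)}$ be the $i$-th explanation predicate selected by the One-shot Top-k mechanism. For all $t$ and all $i\in\{1,\dots,k\}$, $$\Pr\left[\mathrm{Inf}(\mathcal M^{(i)})\le OPT^{(i)}-\frac{2\Delta_{\mathrm{Inf}}}{\sqrt{8\rho_{Topk}/k}}\big(\ln|\mathcal P|+t\big)\right]\le e^{-t}.$$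
   Context: A database is a finite bag of tuples; $D\approx D'$ (neighboring) if one is obtained from the other by adding or removing one tuple. A randomized mechanism $\mathcal M$ is $\rho$-zCDP if $D_\alpha(\mathcal M(D)\|\mathcal M(D'))\le\rho\alpha$ for all $D\approx D'$ and all $\alpha\in(1,\infty)$, where $D_\alpha$ is Rényi divergence of order $\alpha$. An influence function assigns to each $p\in\mathcal P$ and each database $D$ a real number $\mathrm{Inf}(p)=\mathrm{Inf}(p;D)$; it has sensitivity $\Delta_{\mathrm{Inf}}>0$ if $|\mathrm{Inf}(p;D)-\mathrm{Inf}(p;D')|\le\Delta_{\mathrm{Inf}}$ for all $p\in\mathcal P$, $D\approx D'$. **One-shot Top-k mechanism:** with $\sigma=2\Delta_{\mathrm{Inf}}\sqrt{k/(8\rho_{Topk})}$, add to $\mathrm{Inf}(p;D)$, independently for each $p\in\mathcal P$, a Gumbel noise $Z$ with CDF $\Pr[Z\le z]=\exp(-\exp(-z/\sigma))$; sort the predicates in descending order of noisy influence and output the first $k$ predicates in this order. *)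

theory Defs
  imports "HOL-Probability.Probability"
begin

type_synonym 'a database = "'a multiset"

definition neighboring :: "'a database \<Rightarrow> 'a database \<Rightarrow> bool" where
  "neighboring D D' \<longleftrightarrow> (\<exists>x. D' = add_mset x D \<or> D = add_mset x D')"

text \<open>
  The divergence is infinite if \<open>P\<close> is not absolutely continuous with respect to \<open>Q\<close>, or if the
  integral diverges. For probability measures \<open>P\<close> and \<open>Q\<close> on the same sigma-algebra, the density
  is finite almost everywhere, so \<open>enn2real\<close> loses nothing.
\<close>

definition renyi_divergence :: "real \<Rightarrow> 'b measure \<Rightarrow> 'b measure \<Rightarrow> ereal" where
  "renyi_divergence \<alpha> P Q =
     (let I = (\<integral>\<^sup>+ x. ennreal (enn2real (RN_deriv Q P x) powr \<alpha>) \<partial>Q)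
      in if absolutely_continuous Q P \<and> I < \<infinity>
         then ereal (ln (enn2real I) / (\<alpha> - 1)) else \<infinity>)"

text \<open>
  The first two conjuncts say that \<open>M\<close> is a randomized mechanism: its outputs are distributed
  according to probability measures on one measurable space.
\<close>

definition zCDP :: "real \<Rightarrow> ('a database \<Rightarrow> 'b measure) \<Rightarrow> bool" where
  "zCDP \<rho> M \<longleftrightarrow>
     (\<forall>D. prob_space (M D)) \<and>
     (\<forall>D D'. sets (M D) = sets (M D')) \<and>
     (\<forall>D D'. neighboring D D' \<longrightarrow>
        (\<forall>\<alpha>>1. renyi_divergence \<alpha> (M D) (M D') \<le> ereal (\<rho> * \<alpha>)))"

definition has_sensitivity :: "'p set \<Rightarrow> ('p \<Rightarrow> 'a database \<Rightarrow> real) \<Rightarrow> real \<Rightarrow> bool" where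
  "has_sensitivity P infl \<Delta> \<longleftrightarrow>
     \<Delta> > 0 \<and> (\<forall>p\<in>P. \<forall>D D'. neighboring D D' \<longrightarrow> \<bar>infl p D - infl p D'\<bar> \<le> \<Delta>)"

definition gumbel :: "real \<Rightarrow> real measure" where
  "gumbel \<sigma> = interval_measure (\<lambda>z. exp (- exp (- z / \<sigma>)))"

text \<open>
  The predicates are given by an enumeration \<open>ps\<close> without repetitions. Its order serves only to
  break ties between equal noisy influences (the sort is stable), an event of probability zero.
  Negating the key makes the order descending.
\<close>

definition top_k_select :: "nat \<Rightarrow> ('p \<Rightarrow> real) \<Rightarrow> 'p list \<Rightarrow> 'p list" where
  "top_k_select k score ps = take k (sort_key (\<lambda>p. - score p) ps)"

definition one_shot_top_k ::
    "real \<Rightarrow> real \<Rightarrow> nat \<Rightarrow> ('p \<Rightarrow> 'a database \<Rightarrow> real) \<Rightarrow> 'p list \<Rightarrow> 'a database \<Rightarrow> 'p list measure" where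
  "one_shot_top_k \<rho> \<Delta> k infl ps D =
     (let \<sigma> = 2 * \<Delta> * sqrt (real k / (8 * \<rho>))
      in distr (\<Pi>\<^sub>M p\<in>set ps. gumbel \<sigma>) (count_space UNIV)
           (\<lambda>Z. top_k_select k (\<lambda>p. infl p D + Z p) ps))"

text \<open>
  The \<open>i\<close>-th highest true influence for \<open>i\<close> in \<open>{1..card P}\<close>, counted with multiplicity.
\<close>

definition OPT :: "'p set \<Rightarrow> ('p \<Rightarrow> 'a database \<Rightarrow> real) \<Rightarrow> 'a database \<Rightarrow> nat \<Rightarrow> real" where
  "OPT P infl D i =
     rev (sorted_list_of_multiset (image_mset (\<lambda>p. infl p D) (mset_set P))) ! (i - 1)"

end

theory Submission
  imports Defs
begin

text \<open>
  The order of independently Gumbel-perturbed scores follows the Plackett--Luce law: the output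
  is distributed like \<open>k\<close> successive draws without replacement, each from the exponential mechanism
  on the remaining predicates with weights \<open>exp (infl p D / \<sigma>)\<close>. The log-likelihood ratio of one
  draw on neighbouring databases ranges in an interval of length \<open>2 * \<Delta> / \<sigma>\<close>, so two
  applications of Hoeffding's lemma bound its Renyi divergence by \<open>\<alpha> * (2 * \<Delta> / \<sigma>)\<^sup>2 / 8\<close>, and
  the \<open>k\<close> draws compose. For the utility bound, before the \<open>i\<close>-th draw some predicate of influence
  at least \<open>OPT\<close> is left, so each bad predicate is drawn with probability at most \<open>exp (- t) / card P\<close>.
\<close>

subsection \<open>Gumbel distributions\<close>

text \<open>For \<open>c > 0\<close> this is the Gumbel law of scale \<sigma> shifted by
  \<open>\<sigma> * ln c\<close>. The parameter \<open>c\<close> acts as a weight: multiplying CDFs,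
  that is, taking the maximum of independent variables, adds the weights.\<close>

definition scaled_gumbel :: "real \<Rightarrow> real \<Rightarrow> real measure" where
  "scaled_gumbel c \<sigma> = interval_measure (\<lambda>z. exp (- (c * exp (- z / \<sigma>))))"

lemma gumbel_eq_scaled: "gumbel \<sigma> = scaled_gumbel 1 \<sigma>"
  by (simp add: gumbel_def scaled_gumbel_def)

lemma scaled_gumbel_cdf:
  fixes c \<sigma> :: real
  assumes "c > 0" "\<sigma> > 0"
  defines "F \<equiv> \<lambda>z. exp (- (c * exp (- z / \<sigma>)))"
  shows scaled_gumbel_cdf_mono: "\<And>x y. x \<le> y \<Longrightarrow> F x \<le> F y"
    and scaled_gumbel_cdf_right_cont: "\<And>a. continuous (at_right a) F"
    and scaled_gumbel_cdf_at_bot: "(F \<longlongrightarrow> 0) at_bot"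
    and scaled_gumbel_cdf_at_top: "(F \<longlongrightarrow> 1) at_top"
proof -
  show "F x \<le> F y" if "x \<le> y" for x y
    using assms that by (auto simp: F_def field_simps)
  show "continuous (at_right a) F" for a
    unfolding F_def using assms by (intro continuous_intros) auto
  show "(F \<longlongrightarrow> 0) at_bot"
    unfolding F_def using assms by real_asymp
  show "(F \<longlongrightarrow> 1) at_top"
    unfolding F_def using assms by real_asymp
qed

lemma real_distribution_scaled_gumbel:
  assumes "c > 0" "\<sigma> > 0"
  shows "real_distribution (scaled_gumbel c \<sigma>)"
  unfolding scaled_gumbel_def
  by (rule real_distribution_interval_measure) (use scaled_gumbel_cdf[OF assms] in auto)

lemma sets_scaled_gumbel [simp, measurable_cong]: "sets (scaled_gumbel c \<sigma>) = sets borel"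
  by (simp add: scaled_gumbel_def)

lemma sets_gumbel [simp, measurable_cong]: "sets (gumbel \<sigma>) = sets borel"
  by (simp add: gumbel_def)

lemma space_gumbel [simp]: "space (gumbel \<sigma>) = UNIV"
  by (simp add: gumbel_def)

text \<open>Half-open intervals generate the Borel sets, and on each of them both sides are the
  increment of the CDF, by the fundamental theorem of calculus. The density gives null points and
  the tilting identity below.\<close>

lemma scaled_gumbel_density:
  assumes "c > 0" "\<sigma> > 0"
  shows "scaled_gumbel c \<sigma> =
    density lborel (\<lambda>z. ennreal (c / \<sigma> * exp (- z / \<sigma>) * exp (- (c * exp (- z / \<sigma>)))))"
    (is "_ = density lborel (\<lambda>z. ennreal (?f z))")
proof (rule measure_eqI_generator_eq[where \<Omega> = UNIV and E = "range (\<lambda>(a, b). {a<..b})"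
      and A = "\<lambda>i. {- real i<..real i}"])
  let ?F = "\<lambda>z. exp (- (c * exp (- z / \<sigma>)))"
  interpret real_distribution "scaled_gumbel c \<sigma>"
    using assms by (rule real_distribution_scaled_gumbel)
  fix X :: "real set" assume "X \<in> range (\<lambda>(a, b). {a<..b})"
  then obtain a b where X: "X = {a<..b}" by auto
  show "emeasure (scaled_gumbel c \<sigma>) X = emeasure (density lborel (\<lambda>z. ennreal (?f z))) X"
  proof (cases "a \<le> b")
    case True
    have "emeasure (density lborel (\<lambda>z. ennreal (?f z))) X
        = (\<integral>\<^sup>+z. ennreal (?f z) * indicator {a<..b} z \<partial>lborel)"
      by (simp add: X emeasure_density)
    \<comment> \<open>The left endpoint is a Lebesgue null set; closing the interval there makes the
      fundamental theorem applicable.\<close>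
    also have "\<dots> = (\<integral>\<^sup>+z. ennreal (?f z) * indicator {a..b} z \<partial>lborel)"
      by (intro nn_integral_cong_AE, rule AE_mp[OF AE_lborel_singleton[of a]])
         (auto split: split_indicator)
    also have "\<dots> = ennreal (?F b - ?F a)"
    proof (intro nn_integral_FTC_Icc True)
      show "(?F has_real_derivative ?f z) (at z)" for z
        using assms by (auto intro!: derivative_eq_intros)
      show "0 \<le> ?f z" for z using assms by simp
    qed auto
    also have "\<dots> = emeasure (scaled_gumbel c \<sigma>) X"
      unfolding scaled_gumbel_def X
      by (intro emeasure_interval_measure_Ioc[symmetric] True) (use scaled_gumbel_cdf[OF assms] in auto)
    finally show ?thesis ..
  qed (simp add: X)
next
  interpret real_distribution "scaled_gumbel c \<sigma>"
    using assms by (rule real_distribution_scaled_gumbel)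
  show "emeasure (scaled_gumbel c \<sigma>) {- real i<..real i} \<noteq> \<infinity>" for i
    by simp
next
  show "(\<Union>i. {- real (i::nat)<..real i}) = UNIV" by (rule UN_Ioc_eq_UNIV)
qed (auto simp: borel_sigma_sets_Ioc Int_stable_def)

text \<open>The CDF measures closed half-lines, but tie-free selection uses strict inequalities; a
  density leaves no atom at \<open>x\<close>.\<close>

lemma emeasure_scaled_gumbel_Iio:
  assumes "c > 0" "\<sigma> > 0"
  shows "emeasure (scaled_gumbel c \<sigma>) {..<x} = ennreal (exp (- (c * exp (- x / \<sigma>))))"
proof -
  have "AE z in scaled_gumbel c \<sigma>. z \<noteq> x"
    unfolding scaled_gumbel_density[OF assms]
    using AE_lborel_singleton[of x] by (subst AE_density) auto
  then have "emeasure (scaled_gumbel c \<sigma>) {..<x} = emeasure (scaled_gumbel c \<sigma>) {..x}"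
    by (intro emeasure_eq_AE) auto
  also have "\<dots> = ennreal (exp (- (c * exp (- x / \<sigma>))))"
    unfolding scaled_gumbel_def
    by (intro emeasure_interval_measure_Iic) (use scaled_gumbel_cdf[OF assms] in auto)
  finally show ?thesis .
qed

text \<open>The standard density times the CDF of weight \<open>c\<close> is
  \<open>1 / (1 + c)\<close> times the density of weight \<open>1 + c\<close>. The factor
  \<open>1 / (1 + c)\<close> becomes the probability of one draw; \<open>c = 0\<close> covers the
  draw of the last remaining predicate.\<close>

lemma nn_integral_gumbel_tilt:
  assumes "c \<ge> 0" "\<sigma> > 0"
  shows "(\<integral>\<^sup>+z. ennreal (exp (- (c * exp (- z / \<sigma>)))) * indicator {..<x} z \<partial>gumbel \<sigma>)
       = ennreal (exp (- ((1 + c) * exp (- x / \<sigma>))) / (1 + c))"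
proof -
  let ?f = "\<lambda>c z. c / \<sigma> * exp (- z / \<sigma>) * exp (- (c * exp (- z / \<sigma>)))"
  have eq: "?f 1 z * exp (- (c * exp (- z / \<sigma>))) = 1 / (1 + c) * ?f (1 + c) z" for z
  proof -
    have "exp (- ((1 + c) * exp (- z / \<sigma>))) = exp (- exp (- z / \<sigma>)) * exp (- (c * exp (- z / \<sigma>)))"
      by (simp add: algebra_simps flip: exp_add)
    moreover have "1 + c \<noteq> 0" using assms by simp
    ultimately show ?thesis using assms by simp
  qed
  have "(\<integral>\<^sup>+z. ennreal (exp (- (c * exp (- z / \<sigma>)))) * indicator {..<x} z \<partial>gumbel \<sigma>)
      = (\<integral>\<^sup>+z. ennreal (?f 1 z) * (ennreal (exp (- (c * exp (- z / \<sigma>)))) * indicator {..<x} z) \<partial>lborel)"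
    using assms unfolding gumbel_eq_scaled by (subst scaled_gumbel_density, simp, simp, subst nn_integral_density) auto
  also have "\<dots> = (\<integral>\<^sup>+z. ennreal (1 / (1 + c)) * (ennreal (?f (1 + c) z) * indicator {..<x} z) \<partial>lborel)"
  proof (intro nn_integral_cong)
    fix z
    show "ennreal (?f 1 z) * (ennreal (exp (- (c * exp (- z / \<sigma>)))) * indicator {..<x} z)
        = ennreal (1 / (1 + c)) * (ennreal (?f (1 + c) z) * indicator {..<x} z)"
      using assms eq[of z] by (simp only: mult.assoc[symmetric] ennreal_mult[symmetric] divide_nonneg_nonneg zero_le_one exp_ge_zero less_imp_le mult_nonneg_nonneg add_nonneg_nonneg)
  qed
  also have "\<dots> = ennreal (1 / (1 + c)) * emeasure (scaled_gumbel (1 + c) \<sigma>) {..<x}"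
    using assms by (subst nn_integral_cmult) (auto simp: scaled_gumbel_density emeasure_density)
  also have "\<dots> = ennreal (exp (- ((1 + c) * exp (- x / \<sigma>))) / (1 + c))"
    using assms by (simp add: emeasure_scaled_gumbel_Iio flip: ennreal_mult)
  finally show ?thesis .
qed

subsection \<open>Plackett--Luce weights\<close>

text \<open>The list may be shorter than \<open>S\<close> is large: the value is then the
  probability of these first draws without replacement, in this order.\<close>

fun plackett_luce :: "('p \<Rightarrow> real) \<Rightarrow> 'p set \<Rightarrow> 'p list \<Rightarrow> real" where
  "plackett_luce w S [] = 1"
| "plackett_luce w S (p # l) = w p / sum w S * plackett_luce w (S - {p}) l"

lemma plackett_luce_nonneg: "(\<And>p. w p \<ge> 0) \<Longrightarrow> plackett_luce w S l \<ge> 0"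
  by (induction l arbitrary: S) (auto simp: sum_nonneg)

text \<open>Positive atoms make the output laws on neighbouring databases mutually absolutely
  continuous.\<close>

lemma plackett_luce_pos:
  "(\<And>p. w p > 0) \<Longrightarrow> finite S \<Longrightarrow> distinct l \<Longrightarrow> set l \<subseteq> S \<Longrightarrow> plackett_luce w S l > 0"
proof (induction l arbitrary: S)
  case (Cons p l)
  then have "sum w S > 0" by (intro sum_pos) auto
  moreover have "plackett_luce w (S - {p}) l > 0" using Cons.prems by (intro Cons.IH) auto
  ultimately show ?case using Cons.prems by simp
qed simp

definition arrangements :: "nat \<Rightarrow> 'p set \<Rightarrow> 'p list set" where
  "arrangements k S = {l. length l = k \<and> distinct l \<and> set l \<subseteq> S}"

lemma finite_arrangements: "finite S \<Longrightarrow> finite (arrangements k S)"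
  unfolding arrangements_def
  by (rule finite_subset[OF _ finite_lists_length_eq[of S k]]) auto

lemma arrangements_0 [simp]: "arrangements 0 S = {[]}"
  by (auto simp: arrangements_def)

text \<open>Splits off the first entry. The inductions on the number of draws for total mass,
  moments and utility all rest on this recursion.\<close>

lemma sum_arrangements_Suc:
  fixes g :: "'p list \<Rightarrow> 'b :: comm_monoid_add"
  assumes "finite S"
  shows "sum g (arrangements (Suc k) S) = (\<Sum>p\<in>S. \<Sum>l\<in>arrangements k (S - {p}). g (p # l))"
proof -
  have "(\<Sum>p\<in>S. \<Sum>l\<in>arrangements k (S - {p}). g (p # l))
      = (\<Sum>(p, l)\<in>(SIGMA p:S. arrangements k (S - {p})). g (p # l))"
    using assms by (intro sum.Sigma) (auto intro: finite_arrangements)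
  also have "\<dots> = sum g (arrangements (Suc k) S)"
    by (rule sum.reindex_bij_witness[of _ "\<lambda>l. (hd l, tl l)" "\<lambda>(p, l). p # l"])
       (auto simp: arrangements_def length_Suc_conv)
  finally show ?thesis ..
qed

text \<open>Given the first draw, the later draws have total mass 1 by induction;
  \<open>k \<le> card S\<close> keeps every normaliser positive.\<close>

lemma sum_plackett_luce:
  assumes "\<And>p. w p > 0" "finite S" "k \<le> card S"
  shows "(\<Sum>l\<in>arrangements k S. plackett_luce w S l) = 1"
  using assms(2,3)
proof (induction k arbitrary: S)
  case (Suc k)
  have "sum w S > 0" using Suc.prems assms(1) by (intro sum_pos) auto
  have "(\<Sum>l\<in>arrangements (Suc k) S. plackett_luce w S l)
      = (\<Sum>p\<in>S. w p / sum w S * (\<Sum>l\<in>arrangements k (S - {p}). plackett_luce w (S - {p}) l))"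
    using Suc.prems by (simp add: sum_arrangements_Suc sum_distrib_left)
  also have "\<dots> = (\<Sum>p\<in>S. w p / sum w S * 1)"
    using Suc.prems by (intro sum.cong refl arg_cong2[where f = "(*)"] Suc.IH) auto
  also have "\<dots> = 1"
    using \<open>sum w S > 0\<close> by (simp flip: sum_divide_distrib)
  finally show ?case .
qed simp

subsection \<open>Renyi moments\<close>

text \<open>Hoeffding's lemma for the point measure with weights \<open>p\<close>, in uncentred
  form, so that the mean enters the exponent.\<close>

lemma hoeffding_lemma_finite:
  fixes f :: "'b \<Rightarrow> real"
  assumes "finite S" "\<And>x. x \<in> S \<Longrightarrow> p x \<ge> 0" "sum p S = 1" "\<And>x. x \<in> S \<Longrightarrow> f x \<in> {a..b}" "l > 0"
  shows "(\<Sum>x\<in>S. p x * exp (l * f x)) \<le> exp (l * (\<Sum>x\<in>S. p x * f x) + l\<^sup>2 * (b - a)\<^sup>2 / 8)"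
proof -
  let ?M = "point_measure S p"
  define m where "m = (\<Sum>x\<in>S. p x * f x)"
  have "prob_space ?M"
    using assms by (intro prob_spaceI) (simp add: space_point_measure emeasure_point_measure_finite sum_ennreal)
  then interpret prob_space ?M .
  interpret interval_bounded_random_variable ?M f a b
    using assms by unfold_locales (auto simp: AE_point_measure)
  have E: "expectation f = m"
    using assms by (simp add: lebesgue_integral_point_measure_finite m_def)
  have "ennreal (\<Sum>x\<in>S. p x * exp (l * (f x - m))) = (\<integral>\<^sup>+x. ennreal (exp (l * (f x - m))) \<partial>?M)"
    using assms by (simp add: nn_integral_point_measure_finite sum_nonneg flip: ennreal_mult)
  also have "\<dots> \<le> ennreal (exp (l\<^sup>2 * (b - a)\<^sup>2 / 8))"
    using Hoeffdings_lemma_nn_integral[OF \<open>l > 0\<close>] by (simp add: E)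
  finally have "(\<Sum>x\<in>S. p x * exp (l * (f x - m))) \<le> exp (l\<^sup>2 * (b - a)\<^sup>2 / 8)"
    by simp
  then have "exp (l * m) * (\<Sum>x\<in>S. p x * exp (l * (f x - m))) \<le> exp (l * m) * exp (l\<^sup>2 * (b - a)\<^sup>2 / 8)"
    by simp
  also have "exp (l * m) * (\<Sum>x\<in>S. p x * exp (l * (f x - m))) = (\<Sum>x\<in>S. p x * exp (l * f x))"
    by (simp add: sum_distrib_left right_diff_distrib exp_diff)
  finally show ?thesis by (simp add: m_def exp_add)
qed

text \<open>Hoeffding's lemma is applied under \<open>p\<close> to the log-likelihood ratio
  \<open>X\<close>: at parameter 1 to \<open>- X\<close>, which bounds the mean, and at parameter
  \<open>\<alpha> - 1\<close> to \<open>X\<close>. With \<open>d = (b - a)\<^sup>2 / 8\<close> the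
  exponents add up to \<open>(\<alpha> - 1) * d + (\<alpha> - 1)\<^sup>2 * d = \<alpha> * (\<alpha>
  - 1) * d\<close>.\<close>

lemma bounded_range_moment:
  fixes p q :: "'b \<Rightarrow> real"
  assumes "finite S" and pos: "\<And>x. x \<in> S \<Longrightarrow> p x > 0" "\<And>x. x \<in> S \<Longrightarrow> q x > 0"
    and sum: "sum p S = 1" "sum q S = 1"
    and range: "\<And>x. x \<in> S \<Longrightarrow> ln (p x / q x) \<in> {a..b}" and "\<alpha> > 1"
  shows "(\<Sum>x\<in>S. q x * (p x / q x) powr \<alpha>) \<le> exp (\<alpha> * (\<alpha> - 1) * (b - a)\<^sup>2 / 8)"
proof -
  define X where "X x = ln (p x / q x)" for x
  define m where "m = (\<Sum>x\<in>S. p x * X x)"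
  \<comment> \<open>\<open>m\<close> is the Kullback--Leibler divergence of \<open>p\<close> from
    \<open>q\<close>. It is bounded because the mean of \<open>exp (- X)\<close> under
    \<open>p\<close> is the total mass 1 of \<open>q\<close>.\<close>
  have m: "m \<le> (b - a)\<^sup>2 / 8"
  proof -
    have "(\<Sum>x\<in>S. p x * exp (1 * - X x))
        \<le> exp (1 * (\<Sum>x\<in>S. p x * - X x) + 1\<^sup>2 * (- a - - b)\<^sup>2 / 8)"
      using assms by (intro hoeffding_lemma_finite) (auto simp: X_def less_imp_le)
    moreover have "(\<Sum>x\<in>S. p x * exp (1 * - X x)) = sum q S"
    proof (intro sum.cong refl)
      fix x assume "x \<in> S"
      then show "p x * exp (1 * - X x) = q x" using pos[of x] by (simp add: X_def exp_minus)
    qed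
    ultimately have "exp 0 \<le> exp (- m + (b - a)\<^sup>2 / 8)"
      using sum by (simp add: m_def sum_negf)
    then show ?thesis by simp
  qed
  \<comment> \<open>Changing the measure from \<open>q\<close> to \<open>p\<close> absorbs one power
    of the likelihood ratio.\<close>
  have "(\<Sum>x\<in>S. q x * (p x / q x) powr \<alpha>) = (\<Sum>x\<in>S. p x * exp ((\<alpha> - 1) * X x))"
  proof (intro sum.cong refl)
    fix x assume x: "x \<in> S"
    have "q x * (p x / q x) powr \<alpha> = q x * exp (X x + (\<alpha> - 1) * X x)"
      using pos[OF x] by (simp add: powr_def X_def algebra_simps)
    also have "\<dots> = p x * exp ((\<alpha> - 1) * X x)"
      using pos[OF x] by (simp add: exp_add X_def)
    finally show "q x * (p x / q x) powr \<alpha> = p x * exp ((\<alpha> - 1) * X x)" .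
  qed
  also have "\<dots> \<le> exp ((\<alpha> - 1) * m + (\<alpha> - 1)\<^sup>2 * (b - a)\<^sup>2 / 8)"
    unfolding m_def using assms by (intro hoeffding_lemma_finite) (auto simp: X_def less_imp_le)
  also have "\<dots> \<le> exp ((\<alpha> - 1) * ((b - a)\<^sup>2 / 8) + (\<alpha> - 1)\<^sup>2 * (b - a)\<^sup>2 / 8)"
    using m \<open>\<alpha> > 1\<close> by (simp add: mult_left_mono)
  also have "(\<alpha> - 1) * ((b - a)\<^sup>2 / 8) + (\<alpha> - 1)\<^sup>2 * (b - a)\<^sup>2 / 8 = \<alpha> * (\<alpha> - 1) * (b - a)\<^sup>2 / 8"
  proof -
    have "(\<alpha> - 1) * (d / 8) + (\<alpha> - 1)\<^sup>2 * d / 8 = \<alpha> * (\<alpha> - 1) * d / 8" for d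
      by (simp add: power2_eq_square field_simps)
    then show ?thesis .
  qed
  finally show ?thesis .
qed

text \<open>The normalisers contribute the same constant \<open>ln (V / U)\<close> to every
  log-likelihood ratio. It shifts the range but keeps its length \<open>2 * \<delta>\<close>, so no
  estimate of \<open>V / U\<close> enters.\<close>

lemma exponential_mechanism_moment:
  fixes u v :: "'p \<Rightarrow> real"
  assumes "finite S" "S \<noteq> {}" "\<And>p. p \<in> S \<Longrightarrow> \<bar>u p - v p\<bar> \<le> \<delta>" "\<alpha> > 1"
  shows "(\<Sum>p\<in>S. exp (v p) / (\<Sum>p\<in>S. exp (v p))
            * ((exp (u p) / (\<Sum>p\<in>S. exp (u p))) / (exp (v p) / (\<Sum>p\<in>S. exp (v p)))) powr \<alpha>)
         \<le> exp (\<alpha> * (\<alpha> - 1) * \<delta>\<^sup>2 / 2)"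
proof -
  define U where "U = (\<Sum>p\<in>S. exp (u p))"
  define V where "V = (\<Sum>p\<in>S. exp (v p))"
  have UV: "U > 0" "V > 0" using assms unfolding U_def V_def by (auto intro!: sum_pos)
  have ln: "ln ((exp (u p) / U) / (exp (v p) / V)) = u p - v p + ln (V / U)" for p
    using UV by (simp add: ln_div ln_mult)
  have "(\<Sum>p\<in>S. exp (v p) / V * ((exp (u p) / U) / (exp (v p) / V)) powr \<alpha>)
      \<le> exp (\<alpha> * (\<alpha> - 1) * ((\<delta> + ln (V / U)) - (- \<delta> + ln (V / U)))\<^sup>2 / 8)"
  proof (rule bounded_range_moment)
    show "sum (\<lambda>p. exp (u p) / U) S = 1" "sum (\<lambda>p. exp (v p) / V) S = 1"
      using UV by (simp_all add: U_def V_def flip: sum_divide_distrib)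
    show "ln ((exp (u p) / U) / (exp (v p) / V)) \<in> {- \<delta> + ln (V / U)..\<delta> + ln (V / U)}" if "p \<in> S" for p
      using assms(3)[OF that] unfolding ln by auto
  qed (use assms UV in auto)
  also have "\<alpha> * (\<alpha> - 1) * ((\<delta> + ln (V / U)) - (- \<delta> + ln (V / U)))\<^sup>2 / 8 = \<alpha> * (\<alpha> - 1) * \<delta>\<^sup>2 / 2"
    by (simp add: power2_eq_square)
  finally show ?thesis by (simp only: U_def V_def)
qed

text \<open>Adaptive composition: the moment factors at the first draw, and the bound for the
  remaining draws is the same whichever predicate was drawn.\<close>

lemma plackett_luce_moment:
  fixes u v :: "'p \<Rightarrow> real"
  assumes "finite S" "\<And>p. p \<in> S \<Longrightarrow> \<bar>u p - v p\<bar> \<le> \<delta>" "\<alpha> > 1" "k \<le> card S"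
  defines "P \<equiv> plackett_luce (\<lambda>p. exp (u p))" and "Q \<equiv> plackett_luce (\<lambda>p. exp (v p))"
  shows "(\<Sum>l\<in>arrangements k S. Q S l * (P S l / Q S l) powr \<alpha>) \<le> exp (\<alpha> * (\<alpha> - 1) * (k * \<delta>\<^sup>2 / 2))"
  using assms(1,2,4)
proof (induction k arbitrary: S)
  case 0
  then show ?case by (simp add: P_def Q_def)
next
  case (Suc k)
  define p where "p x = exp (u x) / (\<Sum>x\<in>S. exp (u x))" for x
  define q where "q x = exp (v x) / (\<Sum>x\<in>S. exp (v x))" for x
  have nn: "p x \<ge> 0" "q x \<ge> 0" for x unfolding p_def q_def by (simp_all add: sum_nonneg)
  have PQ: "P T l \<ge> 0" "Q T l \<ge> 0" for T l
    unfolding P_def Q_def by (simp_all add: plackett_luce_nonneg)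
  have "(\<Sum>l\<in>arrangements (Suc k) S. Q S l * (P S l / Q S l) powr \<alpha>)
      = (\<Sum>x\<in>S. \<Sum>l\<in>arrangements k (S - {x}).
          q x * Q (S - {x}) l * ((p x * P (S - {x}) l) / (q x * Q (S - {x}) l)) powr \<alpha>)"
    using Suc.prems by (simp add: sum_arrangements_Suc P_def Q_def p_def q_def)
  also have "\<dots> = (\<Sum>x\<in>S. q x * (p x / q x) powr \<alpha> *
      (\<Sum>l\<in>arrangements k (S - {x}). Q (S - {x}) l * (P (S - {x}) l / Q (S - {x}) l) powr \<alpha>))"
  proof -
    have "((p x * r) / (q x * r')) powr \<alpha> = (p x / q x) powr \<alpha> * (r / r') powr \<alpha>"
      if "r \<ge> 0" "r' \<ge> 0" for x r r'
      using nn that by (subst powr_mult[symmetric]) simp_all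
    note * = this[OF PQ]
    show ?thesis by (simp only: sum_distrib_left * mult_ac)
  qed
  also have "\<dots> \<le> (\<Sum>x\<in>S. q x * (p x / q x) powr \<alpha> * exp (\<alpha> * (\<alpha> - 1) * (k * \<delta>\<^sup>2 / 2)))"
    using Suc.prems nn by (intro sum_mono mult_left_mono Suc.IH) auto
  also have "\<dots> = (\<Sum>x\<in>S. q x * (p x / q x) powr \<alpha>) * exp (\<alpha> * (\<alpha> - 1) * (k * \<delta>\<^sup>2 / 2))"
    by (simp add: sum_distrib_right)
  also have "\<dots> \<le> exp (\<alpha> * (\<alpha> - 1) * \<delta>\<^sup>2 / 2) * exp (\<alpha> * (\<alpha> - 1) * (k * \<delta>\<^sup>2 / 2))"
    unfolding p_def q_def using Suc.prems assms(3)
    by (intro mult_right_mono exponential_mechanism_moment) auto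
  also have "\<dots> = exp (\<alpha> * (\<alpha> - 1) * (Suc k * \<delta>\<^sup>2 / 2))"
    unfolding exp_add[symmetric] by (simp add: algebra_simps add_divide_distrib)
  finally show ?case .
qed

text \<open>Both laws live on the finite set \<open>A\<close> with positive atoms, so the quotient
  of atoms is a density of \<open>M\<close> with respect to \<open>N\<close>. By uniqueness it is
  the Radon--Nikodym derivative almost everywhere, and the integral becomes a finite sum.\<close>

lemma renyi_divergence_le_finite:
  assumes "prob_space M" "prob_space N" "sets M = UNIV" "sets N = UNIV"
    and A: "finite A" "AE x in M. x \<in> A" "AE x in N. x \<in> A"
    and pos: "\<And>x. x \<in> A \<Longrightarrow> measure M {x} > 0" "\<And>x. x \<in> A \<Longrightarrow> measure N {x} > 0"
    and "\<alpha> > 1"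
    and le: "(\<Sum>x\<in>A. measure N {x} * (measure M {x} / measure N {x}) powr \<alpha>) \<le> exp ((\<alpha> - 1) * B)"
  shows "renyi_divergence \<alpha> M N \<le> ereal B"
proof -
  interpret M: prob_space M by fact
  interpret N: prob_space N by fact
  note [simp] = \<open>sets M = UNIV\<close> \<open>sets N = UNIV\<close>
  define g where "g x = measure M {x} / measure N {x}" for x
  have meas: "f \<in> borel_measurable N" for f :: "'a \<Rightarrow> ennreal"
    by (simp add: measurable_def)
  have int: "(\<integral>\<^sup>+x. f x \<partial>N) = (\<Sum>x\<in>A. f x * measure N {x})" for f :: "'a \<Rightarrow> ennreal"
  proof -
    have "(\<integral>\<^sup>+x. f x \<partial>N) = (\<integral>\<^sup>+x. (\<Sum>a\<in>A. f a * indicator {a} x) \<partial>N)"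
    proof (intro nn_integral_cong_AE, rule AE_mp[OF A(3)], intro AE_I2 impI)
      fix x assume "x \<in> A"
      then have "(\<Sum>a\<in>A. f a * indicator {a} x) = (\<Sum>a\<in>{x}. f a * indicator {a} x)"
        using A(1) by (intro sum.mono_neutral_right) auto
      then show "f x = (\<Sum>a\<in>A. f a * indicator {a} x)" by simp
    qed
    also have "\<dots> = (\<Sum>x\<in>A. f x * measure N {x})"
      using meas by (simp add: nn_integral_sum nn_integral_cmult_indicator N.emeasure_eq_measure)
    finally show ?thesis .
  qed
  have dens: "density N (\<lambda>x. ennreal (g x)) = M"
  proof (rule measure_eqI_countable_AE[where \<Omega> = A])
    show "AE x in density N (\<lambda>x. ennreal (g x)). x \<in> A"
      using A(3) by (subst AE_density[OF meas]) auto
    fix x assume x: "x \<in> A"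
    have "emeasure (density N (\<lambda>x. ennreal (g x))) {x} = (\<integral>\<^sup>+y. ennreal (g x) * indicator {x} y \<partial>N)"
      by (subst emeasure_density[OF meas]) (auto intro!: nn_integral_cong split: split_indicator)
    also have "\<dots> = ennreal (g x) * ennreal (measure N {x})"
      by (simp add: nn_integral_cmult_indicator N.emeasure_eq_measure)
    also have "\<dots> = ennreal (measure M {x})"
      using pos(2)[OF x] by (simp add: g_def flip: ennreal_mult)
    finally show "emeasure (density N (\<lambda>x. ennreal (g x))) {x} = emeasure M {x}"
      by (simp add: M.emeasure_eq_measure)
  qed (use A in \<open>auto intro: countable_finite\<close>)
  define r where "r = (\<Sum>x\<in>A. measure N {x} * g x powr \<alpha>)"
  \<comment> \<open>A probability measure cannot live on the empty set; hence the moment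
    \<open>r\<close> is positive and the logarithm is monotone there.\<close>
  have "A \<noteq> {}" using A(2) M.AE_False by auto
  then have r: "r > 0"
    unfolding r_def using A(1) pos by (intro sum_pos mult_pos_pos) (auto simp: g_def less_imp_neq[symmetric])
  have "(\<integral>\<^sup>+x. ennreal (enn2real (RN_deriv N M x) powr \<alpha>) \<partial>N) = (\<integral>\<^sup>+x. ennreal (g x powr \<alpha>) \<partial>N)"
  proof (rule nn_integral_cong_AE, rule AE_mp[OF N.RN_deriv_unique[OF meas dens]], intro AE_I2 impI)
    fix x assume "ennreal (g x) = RN_deriv N M x"
    from this[symmetric] show "ennreal (enn2real (RN_deriv N M x) powr \<alpha>) = ennreal (g x powr \<alpha>)"
      by (simp add: g_def)
  qed
  also have "\<dots> = ennreal r"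
    unfolding int r_def by (simp add: mult.commute flip: ennreal_mult)
  finally have I: "(\<integral>\<^sup>+x. ennreal (enn2real (RN_deriv N M x) powr \<alpha>) \<partial>N) = ennreal r" .
  have "absolutely_continuous N M"
    using absolutely_continuousI_density[OF meas] dens by metis
  then have "renyi_divergence \<alpha> M N = ereal (ln r / (\<alpha> - 1))"
    unfolding renyi_divergence_def I Let_def using r by simp
  moreover have "ln r \<le> ln (exp ((\<alpha> - 1) * B))"
    using le r by (subst ln_le_cancel_iff) (auto simp: r_def g_def)
  ultimately show ?thesis
    using \<open>\<alpha> > 1\<close> by (simp add: divide_le_eq mult.commute)
qed

subsection \<open>Utility\<close>

text \<open>
  The invariant is that more than \<open>j\<close> remaining predicates score at least \<open>m\<close>: a single one of them
  already makes the normaliser of the next choice at least \<open>exp (m / \<sigma>)\<close>.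
\<close>

lemma plackett_luce_utility:
  fixes u :: "'p \<Rightarrow> real"
  assumes "finite S" "card S \<le> n" "j < k" "k \<le> card S" "j < card {q\<in>S. u q \<ge> m}" "\<sigma> > 0"
  defines "w \<equiv> \<lambda>p. exp (u p / \<sigma>)"
  shows "(\<Sum>l\<in>{l\<in>arrangements k S. u (l ! j) \<le> m - \<sigma> * (ln (real n) + t)}. plackett_luce w S l) \<le> exp (- t)"
  using assms(1-5)
proof (induction k arbitrary: S j)
  case (Suc k)
  \<comment> \<open>The threshold uses a fixed bound \<open>n\<close> on the number of predicates
    instead of \<open>card S\<close>, so it does not move as \<open>S\<close> shrinks.\<close>
  define c where "c = m - \<sigma> * (ln (real n) + t)"
  have w: "w p > 0" for p by (simp add: w_def)
  have W: "sum w S > 0" using Suc.prems w by (intro sum_pos) auto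
  have n: "n > 0" using Suc.prems by auto
  let ?R = "\<lambda>j k S. \<Sum>l\<in>arrangements k S. if u (l ! j) \<le> c then plackett_luce w S l else 0"
  have R: "?R j k S = (\<Sum>l\<in>{l\<in>arrangements k S. u (l ! j) \<le> c}. plackett_luce w S l)" if "finite S" for j k S
    using that by (simp add: sum.inter_filter finite_arrangements)
  have "?R j (Suc k) S \<le> exp (- t)"
  proof (cases j)
    case 0
    obtain q where q: "q \<in> S" "u q \<ge> m" using Suc.prems by (auto simp: card_gt_0_iff 0)
    have "exp (m / \<sigma>) \<le> w q" using q assms by (simp add: w_def divide_right_mono)
    also have "\<dots> \<le> sum w S" using q Suc.prems w by (intro member_le_sum) (auto simp: less_imp_le)
    finally have Wm: "exp (m / \<sigma>) \<le> sum w S" .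
    have "?R j (Suc k) S = (\<Sum>p\<in>S. if u p \<le> c then w p / sum w S
        * (\<Sum>l\<in>arrangements k (S - {p}). plackett_luce w (S - {p}) l) else 0)"
      using Suc.prems by (auto simp: 0 sum_arrangements_Suc sum_distrib_left intro!: sum.cong)
    \<comment> \<open>Union bound over the at most \<open>n\<close> predicates that could be a bad
      first draw.\<close>
    also have "\<dots> \<le> (\<Sum>p\<in>S. exp (- t) / n)"
    proof (intro sum_mono)
      fix p assume p: "p \<in> S"
      have "(\<Sum>l\<in>arrangements k (S - {p}). plackett_luce w (S - {p}) l) = 1"
        using Suc.prems p w by (intro sum_plackett_luce) auto
      moreover have "w p / sum w S \<le> exp (- t) / n" if "u p \<le> c"
      proof -
        have "w p / sum w S \<le> exp (c / \<sigma>) / exp (m / \<sigma>)"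
          using that assms W Wm unfolding w_def by (intro frac_le) (auto simp: divide_right_mono)
        also have "\<dots> = exp (- t - ln (real n))"
          unfolding exp_diff[symmetric] using assms by (simp add: c_def field_simps)
        also have "\<dots> = exp (- t) / n" using n by (simp add: exp_diff)
        finally show ?thesis .
      qed
      ultimately show "(if u p \<le> c then w p / sum w S
        * (\<Sum>l\<in>arrangements k (S - {p}). plackett_luce w (S - {p}) l) else 0) \<le> exp (- t) / n"
        by simp
    qed
    also have "\<dots> \<le> exp (- t)" using Suc.prems n by (simp add: field_simps)
    finally show ?thesis .
  next
    case (Suc i)
    have "?R j (Suc k) S = (\<Sum>p\<in>S. w p / sum w S * ?R i k (S - {p}))"
      using Suc.prems unfolding sum_distrib_left by (auto simp: Suc sum_arrangements_Suc intro!: sum.cong)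
    also have "\<dots> \<le> (\<Sum>p\<in>S. w p / sum w S * exp (- t))"
    proof (intro sum_mono mult_left_mono)
      fix p assume p: "p \<in> S"
      \<comment> \<open>Drawing \<open>p\<close> removes at most one predicate scoring at least
        \<open>m\<close>, while the index of interest drops from \<open>Suc i\<close> to
        \<open>i\<close>: the invariant survives.\<close>
      have "i < card ({q \<in> S. m \<le> u q} - {p})"
        using Suc.prems(5) Suc by (simp add: card_Diff_singleton_if less_diff_conv)
      also have "{q \<in> S. m \<le> u q} - {p} = {q \<in> S - {p}. m \<le> u q}" by auto
      finally have "i < card {q \<in> S - {p}. m \<le> u q}" .
      moreover have "card (S - {p}) = card S - 1" using p Suc.prems(1) by simp
      ultimately show "?R i k (S - {p}) \<le> exp (- t)"
        unfolding R[OF finite_Diff[OF Suc.prems(1)]] unfolding c_def using Suc.prems(1-4) Suc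
        by (intro Suc.IH finite_Diff) linarith+
      show "0 \<le> w p / sum w S" using W w[of p] by simp
    qed
    also have "\<dots> = exp (- t)"
      using W by (simp flip: sum_distrib_right sum_divide_distrib)
    finally show ?thesis .
  qed
  then show ?case using R[OF Suc.prems(1)] by (simp add: c_def)
qed simp

text \<open>In the descending list the first \<open>i\<close> entries are at least the
  \<open>i\<close>-th. Counting in the multiset keeps predicates of equal influence apart.\<close>

lemma card_ge_OPT:
  assumes "finite P" "1 \<le> i" "i \<le> card P"
  shows "i \<le> card {p\<in>P. infl p D \<ge> OPT P infl D i}"
proof -
  define X where "X = image_mset (\<lambda>p. infl p D) (mset_set P)"
  define xs where "xs = rev (sorted_list_of_multiset X)"
  have X: "mset xs = X" by (simp add: xs_def)
  have len: "length xs = card P" using X assms by (metis X_def size_image_mset size_mset size_mset_set)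
  have sorted: "sorted (rev xs)" by (simp add: xs_def)
  have ge: "xs ! a \<ge> xs ! (i - 1)" if "a < i" for a
    using sorted that assms len by (intro sorted_rev_nth_mono) auto
  have "i \<le> length (filter (\<lambda>x. x \<ge> xs ! (i - 1)) (take i xs @ drop i xs))"
  proof -
    have "filter (\<lambda>x. x \<ge> xs ! (i - 1)) (take i xs) = take i xs"
      using ge assms len by (intro filter_True) (auto simp: in_set_conv_nth)
    then show ?thesis unfolding filter_append using assms len by simp
  qed
  also have "\<dots> = size (filter_mset (\<lambda>x. x \<ge> xs ! (i - 1)) X)"
    unfolding append_take_drop_id by (metis X mset_filter size_mset)
  also have "\<dots> = card {p\<in>P. infl p D \<ge> xs ! (i - 1)}"
    using assms by (simp add: X_def filter_mset_image_mset)
  finally show ?thesis by (simp add: OPT_def xs_def X_def)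
qed

subsection \<open>Distribution of the noisy selection\<close>

text \<open>Tie-free selection: the scores along the list decrease strictly from below
  \<open>x\<close>, and the rest of \<open>S\<close> stays below the last of them. The bound
  \<open>x\<close> closes the recursion, since each drawn score bounds what follows.\<close>

fun selection :: "real \<Rightarrow> 'p list \<Rightarrow> 'p set \<Rightarrow> ('p \<Rightarrow> real) \<Rightarrow> bool" where
  "selection x [] S s \<longleftrightarrow> (\<forall>q\<in>S. s q < x)"
| "selection x (p # l) S s \<longleftrightarrow> p \<in> S \<and> s p < x \<and> selection (s p) l (S - {p}) s"

lemma selection_less: "selection x l S s \<Longrightarrow> q \<in> S \<Longrightarrow> s q < x"
proof (induction l arbitrary: x S)
  case (Cons p l)
  then show ?case by (cases "q = p") fastforce+
qed simp

lemma selection_cong: "(\<And>q. q \<in> S \<Longrightarrow> s q = s' q) \<Longrightarrow> selection x l S s = selection x l S s'"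
proof (induction l arbitrary: x S)
  case (Cons p l)
  have "selection (s p) l (S - {p}) s = selection (s p) l (S - {p}) s'"
    using Cons.prems by (intro Cons.IH) auto
  with Cons.prems show ?case by auto
qed simp

text \<open>The bound is a measurable function of the noise because after one draw it becomes
  \<open>u p + Z p\<close>. The index set \<open>T\<close> stays fixed while \<open>S\<close>
  shrinks.\<close>

lemma measurable_selection:
  fixes u :: "'p \<Rightarrow> real"
  assumes "finite S" "S \<subseteq> T" "f \<in> borel_measurable (Pi\<^sub>M T (\<lambda>_. gumbel \<sigma>))"
  shows "Measurable.pred (Pi\<^sub>M T (\<lambda>_. gumbel \<sigma>)) (\<lambda>Z. selection (f Z) l S (\<lambda>p. u p + Z p))"
  using assms
proof (induction l arbitrary: S f)
  case Nil
  have [measurable]: "(\<lambda>Z. Z q) \<in> borel_measurable (Pi\<^sub>M T (\<lambda>_. gumbel \<sigma>))" if "q \<in> S" for q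
    using measurable_component_singleton[of q T "\<lambda>_. gumbel \<sigma>"] that Nil.prems
    by (auto simp: gumbel_eq_scaled)
  note [measurable] = Nil.prems(3)
  show ?case
    using Nil.prems unfolding selection.simps by (intro pred_intros_finite(3)) measurable
next
  case (Cons p l)
  show ?case
  proof (cases "p \<in> S")
    case True
    have [measurable]: "(\<lambda>Z. Z p) \<in> borel_measurable (Pi\<^sub>M T (\<lambda>_. gumbel \<sigma>))"
      using measurable_component_singleton[of p T "\<lambda>_. gumbel \<sigma>"] True Cons.prems
      by (auto simp: gumbel_eq_scaled)
    note [measurable] = Cons.prems(3)
    have [measurable]: "Measurable.pred (Pi\<^sub>M T (\<lambda>_. gumbel \<sigma>))
        (\<lambda>Z. selection (u p + Z p) l (S - {p}) (\<lambda>p. u p + Z p))"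
      using Cons.prems by (intro Cons.IH) auto
    show ?thesis using True by simp
  qed simp
qed

text \<open>
  The first selected predicate is conditioned on: given its noisy score, the rest is an instance
  of the claim on the remaining predicates with that score as the new upper bound.
\<close>

lemma emeasure_selection:
  fixes u :: "'p \<Rightarrow> real"
  assumes "\<sigma> > 0" "finite S" "distinct l" "set l \<subseteq> S"
  defines "w \<equiv> \<lambda>p. exp (u p / \<sigma>)"
  shows "emeasure (Pi\<^sub>M S (\<lambda>_. gumbel \<sigma>))
           {Z \<in> space (Pi\<^sub>M S (\<lambda>_. gumbel \<sigma>)). selection x l S (\<lambda>p. u p + Z p)}
       = ennreal (plackett_luce w S l * exp (- (sum w S * exp (- x / \<sigma>))))"
  using assms(2-4)
proof (induction l arbitrary: x S)
  case Nil
  interpret real_distribution "gumbel \<sigma>"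
    unfolding gumbel_eq_scaled using assms by (intro real_distribution_scaled_gumbel) auto
  interpret product_sigma_finite "\<lambda>_. gumbel \<sigma>" by standard
  \<comment> \<open>Shifting a Gumbel variable by \<open>u q\<close> multiplies its weight by
    \<open>w q\<close>.\<close>
  have shift: "w q * exp (- x / \<sigma>) = exp (- (x - u q) / \<sigma>)" for q
    by (simp add: w_def diff_divide_distrib flip: exp_add)
  \<comment> \<open>With no draw left the event is a box, so its probability is a product of CDFs
    and the weights add up.\<close>
  have "{Z \<in> space (Pi\<^sub>M S (\<lambda>_. gumbel \<sigma>)). selection x [] S (\<lambda>p. u p + Z p)}
      = Pi\<^sub>E S (\<lambda>q. {..<x - u q})"
    by (auto simp: space_PiM PiE_iff algebra_simps intro: extensional_arb)
  then have "emeasure (Pi\<^sub>M S (\<lambda>_. gumbel \<sigma>))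
      {Z \<in> space (Pi\<^sub>M S (\<lambda>_. gumbel \<sigma>)). selection x [] S (\<lambda>p. u p + Z p)}
      = (\<Prod>q\<in>S. emeasure (gumbel \<sigma>) {..<x - u q})"
    using Nil by (simp add: emeasure_PiM)
  also have "\<dots> = (\<Prod>q\<in>S. ennreal (exp (- exp (- (x - u q) / \<sigma>))))"
    using assms by (simp add: gumbel_eq_scaled emeasure_scaled_gumbel_Iio)
  also have "\<dots> = ennreal (exp (\<Sum>q\<in>S. - exp (- (x - u q) / \<sigma>)))"
    using Nil by (simp add: prod_ennreal exp_sum)
  also have "(\<Sum>q\<in>S. - exp (- (x - u q) / \<sigma>)) = - (sum w S * exp (- x / \<sigma>))"
    by (simp only: shift[symmetric] sum_negf sum_distrib_right)
  finally show ?case by simp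
next
  case (Cons p l)
  define S' where "S' = S - {p}"
  have S: "S = insert p S'" and p: "p \<notin> S'" and fin: "finite S'" and l: "set l \<subseteq> S'" "distinct l"
    using Cons.prems by (auto simp: S'_def)
  interpret real_distribution "gumbel \<sigma>"
    unfolding gumbel_eq_scaled using assms by (intro real_distribution_scaled_gumbel) auto
  interpret product_sigma_finite "\<lambda>_. gumbel \<sigma>" by standard
  let ?M = "\<lambda>S. Pi\<^sub>M S (\<lambda>_. gumbel \<sigma>)"
  define A where "A = {Z \<in> space (?M S). selection x (p # l) S (\<lambda>p. u p + Z p)}"
  have A: "A \<in> sets (?M S)"
    unfolding A_def using measurable_selection[OF Cons.prems(1) subset_refl, of "\<lambda>_. x" \<sigma> "p # l" u]
    by (simp add: pred_def)
  \<comment> \<open>The remaining weight relative to that of \<open>p\<close>, as seen when the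
    bound on the remaining scores is expressed through the noise \<open>y\<close> of
    \<open>p\<close>.\<close>
  define c where "c = sum w S' / w p"
  have wp: "w p > 0" and c0: "c \<ge> 0" and pl: "plackett_luce w S' l \<ge> 0"
    using plackett_luce_nonneg[of w S' l] by (auto simp: w_def sum_nonneg c_def)
  have sel: "selection x (p # l) S (\<lambda>q. u q + (Z(p := y)) q) \<longleftrightarrow>
      y \<in> {..<x - u p} \<and> selection (u p + y) l S' (\<lambda>q. u q + Z q)" for Z y
  proof -
    have "selection (u p + y) l S' (\<lambda>q. u q + (Z(p := y)) q) = selection (u p + y) l S' (\<lambda>q. u q + Z q)"
      using p by (intro selection_cong) auto
    moreover have "p \<in> S" using Cons.prems by simp
    ultimately show ?thesis by (auto simp: S'_def[symmetric] less_diff_eq add.commute)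
  qed
  have "emeasure (?M S) A = (\<integral>\<^sup>+Z. indicator A Z \<partial>?M S)"
    using A by simp
  \<comment> \<open>Fubini: the noise \<open>y\<close> of the drawn predicate outside, the noise of
    the others inside.\<close>
  also have "\<dots> = (\<integral>\<^sup>+y. (\<integral>\<^sup>+Z. indicator A (Z(p := y)) \<partial>?M S') \<partial>gumbel \<sigma>)"
    unfolding S using fin p A[unfolded S] by (intro product_nn_integral_insert_rev) auto
  also have "\<dots> = (\<integral>\<^sup>+y. ennreal (plackett_luce w S' l)
        * (ennreal (exp (- (c * exp (- y / \<sigma>)))) * indicator {..<x - u p} y) \<partial>gumbel \<sigma>)"
  proof (intro nn_integral_cong)
    fix y
    let ?B = "{Z \<in> space (?M S'). selection (u p + y) l S' (\<lambda>q. u q + Z q)}"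
    have B: "?B \<in> sets (?M S')"
      using measurable_selection[OF fin subset_refl, of "\<lambda>_. u p + y" \<sigma> l u] by (simp add: pred_def)
    have "(\<integral>\<^sup>+Z. indicator A (Z(p := y)) \<partial>?M S')
        = (\<integral>\<^sup>+Z. indicator {..<x - u p} y * indicator ?B Z \<partial>?M S')"
    proof (intro nn_integral_cong)
      fix Z assume Z: "Z \<in> space (?M S')"
      then have "Z(p := y) \<in> space (?M S)"
        by (auto simp: S space_PiM PiE_def extensional_def)
      with Z sel[of Z y] show "(indicator A (Z(p := y)) :: ennreal) = indicator {..<x - u p} y * indicator ?B Z"
        unfolding A_def by (simp add: indicator_def)
    qed
    also have "\<dots> = indicator {..<x - u p} y * emeasure (?M S') ?B"
      using B by (simp add: nn_integral_cmult)
    also have "emeasure (?M S') ?B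
        = ennreal (plackett_luce w S' l * exp (- (sum w S' * exp (- (u p + y) / \<sigma>))))"
      using fin l by (intro Cons.IH) auto
    also have "sum w S' * exp (- (u p + y) / \<sigma>) = c * exp (- y / \<sigma>)"
    proof -
      have "- (u p + y) / \<sigma> = - y / \<sigma> - u p / \<sigma>" by (simp add: diff_divide_distrib)
      then show ?thesis by (simp add: c_def w_def exp_diff)
    qed
    finally show "(\<integral>\<^sup>+Z. indicator A (Z(p := y)) \<partial>?M S')
      = ennreal (plackett_luce w S' l) * (ennreal (exp (- (c * exp (- y / \<sigma>)))) * indicator {..<x - u p} y)"
      using pl by (simp add: ennreal_mult mult_ac fun_upd_def)
  qed
  also have "\<dots> = ennreal (plackett_luce w S' l)
        * ennreal (exp (- ((1 + c) * exp (- (x - u p) / \<sigma>))) / (1 + c))"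
    using assms c0 nn_integral_gumbel_tilt[of c \<sigma> "x - u p"]
    by (subst nn_integral_cmult) auto
  also have "\<dots> = ennreal (plackett_luce w S' l * (exp (- ((1 + c) * exp (- (x - u p) / \<sigma>))) / (1 + c)))"
    using pl c0 by (intro ennreal_mult[symmetric]) auto
  \<comment> \<open>Thus \<open>1 / (1 + c)\<close> is the probability \<open>w p / sum w S\<close>
    of drawing \<open>p\<close> first.\<close>
  also have "1 + c = sum w S / w p"
    using fin p wp by (simp add: S c_def field_simps)
  also have "sum w S / w p * exp (- (x - u p) / \<sigma>) = sum w S * exp (- x / \<sigma>)"
  proof -
    have "- (x - u p) / \<sigma> = - x / \<sigma> + u p / \<sigma>" by (simp add: diff_divide_distrib)
    then have "exp (- (x - u p) / \<sigma>) = exp (- x / \<sigma>) * w p" by (simp only: exp_add w_def)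
    then show ?thesis using wp by simp
  qed
  finally show ?case
    unfolding A_def using wp by (simp add: S'_def field_simps)
qed

section \<open>Sorting by noisy scores\<close>

lemma sort_key_cong_le:
  assumes "\<And>x y. x \<in> set xs \<Longrightarrow> y \<in> set xs \<Longrightarrow> f x \<le> f y \<longleftrightarrow> g x \<le> g y"
  shows "sort_key f xs = sort_key g xs"
proof -
  have insort: "insort_key f x ys = insort_key g x ys"
    if "\<And>y. y \<in> set ys \<Longrightarrow> f x \<le> f y \<longleftrightarrow> g x \<le> g y" for x ys
    using that by (induction ys) auto
  show ?thesis
    using assms by (induction xs) (auto intro!: insort)
qed

text \<open>The head of the sorted list has maximal score, and every predicate other than
  \<open>p\<close> scores strictly less than \<open>p\<close>; so the head is \<open>p\<close>, and
  the tail follows by induction.\<close>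

lemma selection_imp_take:
  assumes "selection x l (set xs) s" "distinct xs" "sorted (map (\<lambda>p. - s p) xs)"
  shows "take (length l) xs = l"
  using assms
proof (induction l arbitrary: x xs)
  case (Cons p l)
  then obtain q ys where xs: "xs = q # ys" by (cases xs) auto
  have sel: "selection (s p) l (set xs - {p}) s" and p: "p \<in> set xs"
    using Cons.prems by auto
  have "q = p"
  proof (rule ccontr)
    assume "q \<noteq> p"
    then have "s q < s p" using selection_less[OF sel, of q] xs by simp
    moreover have "s p \<le> s q" using Cons.prems p \<open>q \<noteq> p\<close> by (auto simp: xs)
    ultimately show False by simp
  qed
  then have "set xs - {p} = set ys" using Cons.prems by (auto simp: xs)
  with sel Cons.prems have "take (length l) ys = l"
    by (intro Cons.IH[of "s p"]) (auto simp: xs)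
  then show ?case by (simp add: xs \<open>q = p\<close>)
qed simp

lemma selection_imp_top_k_select:
  assumes "selection x l (set ps) s" "distinct ps"
  shows "top_k_select (length l) s ps = l"
  unfolding top_k_select_def
  by (rule selection_imp_take[of x]) (use assms in auto)

lemma top_k_select_in_arrangements:
  assumes "distinct ps" "k \<le> length ps"
  shows "top_k_select k s ps \<in> arrangements k (set ps)"
  using assms set_take_subset[of k "sort_key (\<lambda>p. - s p) ps"]
  by (simp add: arrangements_def top_k_select_def)

text \<open>The output depends on the noise only through the comparisons between noisy scores. The
  relation \<open>rel\<close> recording them takes finitely many values, each on a measurable
  set.\<close>

lemma measurable_top_k_select:
  "(\<lambda>Z. top_k_select k (\<lambda>p. u p + Z p) ps) \<in> Pi\<^sub>M (set ps) (\<lambda>_. gumbel \<sigma>) \<rightarrow>\<^sub>M count_space UNIV"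
proof -
  define S where "S = set ps"
  let ?M = "Pi\<^sub>M S (\<lambda>_. gumbel \<sigma>)"
  define rel where "rel Z = {(p, q) \<in> S \<times> S. u p + Z p \<le> u q + Z q}" for Z
  \<comment> \<open>Any noise vector inducing \<open>R\<close> yields the same sorted list, so an
    arbitrary representative factors the output through \<open>rel\<close>.\<close>
  define h where "h R = top_k_select k (\<lambda>p. u p + (SOME Z. rel Z = R) p) ps" for R
  have component: "(\<lambda>Z. Z q) \<in> borel_measurable ?M" if "q \<in> S" for q
    using measurable_component_singleton[of q S "\<lambda>_. gumbel \<sigma>"] that by simp
  have le: "Measurable.pred ?M (\<lambda>Z. u p + Z p \<le> u q + Z q)" if "p \<in> S" "q \<in> S" for p q
    unfolding pred_def
    by (intro borel_measurable_le borel_measurable_add borel_measurable_const component that)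
  have fin: "finite S" by (simp add: S_def)
  have rel_set: "{Z \<in> space ?M. \<forall>(p, q)\<in>S \<times> S. (p, q) \<in> R \<longleftrightarrow> u p + Z p \<le> u q + Z q} \<in> sets ?M" for R
    unfolding case_prod_beta pred_def[symmetric]
    by (intro pred_intros_finite(3)) (auto simp: S_def[symmetric] fin intro!: pred_intros_logic le)
  have "rel \<in> ?M \<rightarrow>\<^sub>M count_space (Pow (S \<times> S))"
  proof (rule measurable_count_space_eq2[THEN iffD2])
    show "finite (Pow (S \<times> S))" by (simp add: S_def)
    show "rel \<in> space ?M \<rightarrow> Pow (S \<times> S) \<and> (\<forall>R\<in>Pow (S \<times> S). rel -` {R} \<inter> space ?M \<in> sets ?M)"
    proof (intro conjI ballI)
      fix R assume "R \<in> Pow (S \<times> S)"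
      then have "rel -` {R} \<inter> space ?M = {Z \<in> space ?M. \<forall>(p, q)\<in>S \<times> S. (p, q) \<in> R \<longleftrightarrow> u p + Z p \<le> u q + Z q}"
        by (fastforce simp: rel_def)
      then show "rel -` {R} \<inter> space ?M \<in> sets ?M" using rel_set by simp
    qed (auto simp: rel_def)
  qed
  then have "(\<lambda>Z. h (rel Z)) \<in> ?M \<rightarrow>\<^sub>M count_space UNIV"
    by (rule measurable_compose) simp
  also have "(\<lambda>Z. h (rel Z)) = (\<lambda>Z. top_k_select k (\<lambda>p. u p + Z p) ps)"
  proof
    fix Z
    define Z' where "Z' = (SOME Z'. rel Z' = rel Z)"
    have "rel Z' = rel Z" unfolding Z'_def by (rule someI[where P = "\<lambda>Z'. rel Z' = rel Z"]) (rule refl)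
    then have "u p + Z' p \<le> u q + Z' q \<longleftrightarrow> u p + Z p \<le> u q + Z q" if "p \<in> S" "q \<in> S" for p q
      using that by (auto simp: rel_def set_eq_iff)
    then show "h (rel Z) = top_k_select k (\<lambda>p. u p + Z p) ps"
      unfolding h_def Z'_def[symmetric] top_k_select_def
      by (intro arg_cong[where f = "take k"] sort_key_cong_le) (simp add: S_def neg_le_iff_le del: minus_add_distrib)
  qed
  finally show ?thesis unfolding S_def .
qed

section \<open>Law of the output list\<close>

definition noisy_top_k :: "real \<Rightarrow> nat \<Rightarrow> ('p \<Rightarrow> real) \<Rightarrow> 'p list \<Rightarrow> 'p list measure" where
  "noisy_top_k \<sigma> k u ps = distr (Pi\<^sub>M (set ps) (\<lambda>_. gumbel \<sigma>)) (count_space UNIV)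
     (\<lambda>Z. top_k_select k (\<lambda>p. u p + Z p) ps)"

lemma prob_space_PiM_gumbel: "\<sigma> > 0 \<Longrightarrow> prob_space (Pi\<^sub>M S (\<lambda>_. gumbel \<sigma>))"
  unfolding gumbel_eq_scaled
  by (intro prob_space_PiM real_distribution.axioms(1) real_distribution_scaled_gumbel) auto

lemma prob_space_noisy_top_k: "\<sigma> > 0 \<Longrightarrow> prob_space (noisy_top_k \<sigma> k u ps)"
  unfolding noisy_top_k_def
  by (intro prob_space.prob_space_distr prob_space_PiM_gumbel measurable_top_k_select)

lemma sets_noisy_top_k [simp]: "sets (noisy_top_k \<sigma> k u ps) = UNIV"
  by (simp add: noisy_top_k_def)

lemma space_noisy_top_k [simp]: "space (noisy_top_k \<sigma> k u ps) = UNIV"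
  by (simp add: noisy_top_k_def)

lemma AE_noisy_top_k:
  "distinct ps \<Longrightarrow> k \<le> length ps \<Longrightarrow> AE l in noisy_top_k \<sigma> k u ps. l \<in> arrangements k (set ps)"
  unfolding noisy_top_k_def
  by (subst AE_distr_iff[OF measurable_top_k_select]) (auto intro: top_k_select_in_arrangements)

text \<open>
  The probability of selecting \<open>l\<close> without ties is a lower bound for that of the output \<open>l\<close>. Since
  these lower bounds already sum to one, they are attained, and ties need no separate treatment.
\<close>

lemma measure_noisy_top_k:
  fixes u :: "'p \<Rightarrow> real"
  assumes "\<sigma> > 0" "distinct ps" "k \<le> length ps" "l \<in> arrangements k (set ps)"
  shows "measure (noisy_top_k \<sigma> k u ps) {l} = plackett_luce (\<lambda>p. exp (u p / \<sigma>)) (set ps) l"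
proof -
  define S where "S = set ps"
  define w where "w p = exp (u p / \<sigma>)" for p
  let ?G = "Pi\<^sub>M S (\<lambda>_. gumbel \<sigma>)"
  let ?M = "noisy_top_k \<sigma> k u ps"
  let ?A = "arrangements k S"
  have fin: "finite ?A" by (simp add: S_def finite_arrangements)
  interpret G: prob_space ?G using assms(1) by (rule prob_space_PiM_gumbel)
  interpret M: prob_space ?M using assms(1) by (rule prob_space_noisy_top_k)
  have lower: "plackett_luce w S l \<le> measure ?M {l}" if l: "l \<in> ?A" for l
  proof (rule tendsto_upperbound)
    \<comment> \<open>Letting \<open>x\<close> tend to infinity removes the bound on the top score:
      its factor tends to 1 and the Plackett--Luce weight remains.\<close>
    show "((\<lambda>x. plackett_luce w S l * exp (- (sum w S * exp (- x / \<sigma>)))) \<longlongrightarrow> plackett_luce w S l) at_top"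
    proof -
      have "((\<lambda>x. exp (- x / \<sigma>)) \<longlongrightarrow> 0) at_top" using \<open>\<sigma> > 0\<close> by real_asymp
      then have "((\<lambda>x. plackett_luce w S l * exp (- (sum w S * exp (- x / \<sigma>))))
          \<longlongrightarrow> plackett_luce w S l * exp (- (sum w S * 0))) at_top"
        by (intro tendsto_intros)
      then show ?thesis by simp
    qed
    show "\<forall>\<^sub>F x in at_top. plackett_luce w S l * exp (- (sum w S * exp (- x / \<sigma>))) \<le> measure ?M {l}"
    proof (intro always_eventually allI)
      fix x
      have "ennreal (plackett_luce w S l * exp (- (sum w S * exp (- x / \<sigma>))))
          = emeasure ?G {Z \<in> space ?G. selection x l S (\<lambda>p. u p + Z p)}"
        unfolding w_def using assms l
        by (intro emeasure_selection[symmetric]) (auto simp: S_def arrangements_def)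
      also have "\<dots> \<le> emeasure ?G ((\<lambda>Z. top_k_select k (\<lambda>p. u p + Z p) ps) -` {l} \<inter> space ?G)"
      proof (rule emeasure_mono)
        show "(\<lambda>Z. top_k_select k (\<lambda>p. u p + Z p) ps) -` {l} \<inter> space ?G \<in> sets ?G"
          unfolding S_def by (rule measurable_sets[OF measurable_top_k_select]) simp
      qed (use l assms selection_imp_top_k_select[of x l ps] in \<open>auto simp: S_def arrangements_def\<close>)
      also have "\<dots> = emeasure ?M {l}"
        unfolding noisy_top_k_def S_def by (subst emeasure_distr[OF measurable_top_k_select]) auto
      finally show "plackett_luce w S l * exp (- (sum w S * exp (- x / \<sigma>))) \<le> measure ?M {l}"
        by (simp add: M.emeasure_eq_measure)
    qed
  qed simp
  have "(\<Sum>l\<in>?A. measure ?M {l} - plackett_luce w S l) = measure ?M ?A - 1"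
  proof -
    have "(\<Sum>l\<in>?A. plackett_luce w S l) = 1"
      using assms by (intro sum_plackett_luce) (auto simp: w_def S_def distinct_card)
    then show ?thesis
      using M.finite_measure_eq_sum_singleton[OF fin] by (simp add: sum_subtractf)
  qed
  also have "\<dots> \<le> 0" by simp
  finally have "(\<Sum>l\<in>?A. measure ?M {l} - plackett_luce w S l) = 0"
    using lower by (intro antisym sum_nonneg) auto
  then have "\<forall>l\<in>?A. measure ?M {l} - plackett_luce w S l = 0"
    using lower by (subst (asm) sum_nonneg_eq_0_iff[OF fin]) auto
  with assms(4) show ?thesis by (simp add: S_def w_def[abs_def])
qed

subsection \<open>The one-shot mechanism\<close>

theorem proposition4p6:
  fixes infl :: "'p \<Rightarrow> 'a database \<Rightarrow> real" and P :: "'p set" and ps :: "'p list"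
    and \<Delta> \<rho> :: real and k :: nat
  assumes "finite P" and "distinct ps" and "set ps = P"
    and "has_sensitivity P infl \<Delta>"
    and "\<rho> > 0"
    and "1 \<le> k" and "k \<le> card P"
  shows "(\<forall>D. AE out in one_shot_top_k \<rho> \<Delta> k infl ps D.
            length out = k \<and> distinct out \<and> set out \<subseteq> P)
       \<and> zCDP \<rho> (one_shot_top_k \<rho> \<Delta> k infl ps)
       \<and> (\<forall>D. \<forall>t :: real. \<forall>i\<in>{1..k}.
            \<P>(out in one_shot_top_k \<rho> \<Delta> k infl ps D.
               infl (out ! (i - 1)) D
                 \<le> OPT P infl D i - 2 * \<Delta> / sqrt (8 * \<rho> / real k) * (ln (real (card P)) + t))
            \<le> exp (- t))"
proof -
  define \<sigma> where "\<sigma> = 2 * \<Delta> * sqrt (real k / (8 * \<rho>))"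
  have \<Delta>: "\<Delta> > 0" using assms(4) by (simp add: has_sensitivity_def)
  have \<sigma>: "\<sigma> > 0" using \<Delta> assms by (simp add: \<sigma>_def)
  have len: "length ps = card P" using assms distinct_card by force
  have M: "one_shot_top_k \<rho> \<Delta> k infl ps D = noisy_top_k \<sigma> k (\<lambda>p. infl p D) ps" for D
    by (simp add: one_shot_top_k_def noisy_top_k_def \<sigma>_def)
  let ?M = "\<lambda>D. noisy_top_k \<sigma> k (\<lambda>p. infl p D) ps"
  let ?PL = "\<lambda>D. plackett_luce (\<lambda>p. exp (infl p D / \<sigma>)) P"
  let ?A = "arrangements k P"
  have fin: "finite ?A" using assms by (simp add: finite_arrangements)
  have AE: "AE out in ?M D. out \<in> ?A" for D
    using AE_noisy_top_k[of ps k \<sigma> "\<lambda>p. infl p D"] assms len by simp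
  have single: "measure (?M D) {l} = ?PL D l" if "l \<in> ?A" for D l
    using measure_noisy_top_k[of \<sigma> ps k l "\<lambda>p. infl p D"] that assms len \<sigma> by simp
  have pos: "?PL D l > 0" if "l \<in> ?A" for D l
    using that assms by (intro plackett_luce_pos) (auto simp: arrangements_def)
  have valid: "AE out in one_shot_top_k \<rho> \<Delta> k infl ps D. length out = k \<and> distinct out \<and> set out \<subseteq> P" for D
    using AE[of D] unfolding M arrangements_def by simp
  have "zCDP \<rho> ?M"
    unfolding zCDP_def
  proof (intro conjI allI impI)
    show "prob_space (?M D)" for D using \<sigma> by (rule prob_space_noisy_top_k)
    fix D D' :: "'a database" and \<alpha> :: real
    assume "neighboring D D'" and \<alpha>: "1 < \<alpha>"
    have near: "\<bar>infl p D / \<sigma> - infl p D' / \<sigma>\<bar> \<le> \<Delta> / \<sigma>" if "p \<in> P" for p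
    proof -
      have "\<bar>infl p D - infl p D'\<bar> \<le> \<Delta>"
        using assms(4) that \<open>neighboring D D'\<close> by (auto simp: has_sensitivity_def)
      then have "\<bar>(infl p D - infl p D') / \<sigma>\<bar> \<le> \<Delta> / \<sigma>"
        using \<sigma> by (simp add: abs_divide divide_right_mono)
      then show ?thesis by (simp add: diff_divide_distrib)
    qed
    \<comment> \<open>The calibration of the noise:
      \<open>\<sigma>\<^sup>2 = \<Delta>\<^sup>2 * k / (2 * \<rho>)\<close>, so each of the
      \<open>k\<close> draws costs \<open>\<rho> / k\<close>.\<close>
    have budget: "real k * (\<Delta> / \<sigma>)\<^sup>2 / 2 = \<rho>"
      using \<Delta> assms by (simp add: \<sigma>_def power_divide power_mult_distrib field_simps)
    have "(\<Sum>l\<in>?A. ?PL D' l * (?PL D l / ?PL D' l) powr \<alpha>) \<le> exp (\<alpha> * (\<alpha> - 1) * (real k * (\<Delta> / \<sigma>)\<^sup>2 / 2))"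
      using assms near \<alpha> by (intro plackett_luce_moment) auto
    then have "(\<Sum>l\<in>?A. ?PL D' l * (?PL D l / ?PL D' l) powr \<alpha>) \<le> exp ((\<alpha> - 1) * (\<rho> * \<alpha>))"
      unfolding budget by (simp add: mult_ac)
    then show "renyi_divergence \<alpha> (?M D) (?M D') \<le> ereal (\<rho> * \<alpha>)"
      using \<sigma> \<alpha> fin AE single pos
      by (intro renyi_divergence_le_finite[where A = ?A] prob_space_noisy_top_k) simp_all
  qed simp
  moreover have "\<P>(out in ?M D. infl (out ! (i - 1)) D
      \<le> OPT P infl D i - 2 * \<Delta> / sqrt (8 * \<rho> / real k) * (ln (real (card P)) + t)) \<le> exp (- t)"
    if i: "i \<in> {1..k}" for D t i
  proof -
    have \<sigma>': "2 * \<Delta> / sqrt (8 * \<rho> / real k) = \<sigma>"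
      by (simp add: \<sigma>_def real_sqrt_divide)
    interpret prob_space "?M D" using \<sigma> by (rule prob_space_noisy_top_k)
    let ?B = "{out. infl (out ! (i - 1)) D \<le> OPT P infl D i - \<sigma> * (ln (real (card P)) + t)}"
    \<comment> \<open>The event is first restricted to genuine outputs, where the atoms are
      known.\<close>
    have "prob ?B = prob {out \<in> ?A. out \<in> ?B}"
      using AE[of D] by (intro finite_measure_eq_AE) auto
    also have "\<dots> = (\<Sum>l\<in>{out \<in> ?A. out \<in> ?B}. ?PL D l)"
      using fin single by (subst finite_measure_eq_sum_singleton) auto
    also have "\<dots> \<le> exp (- t)"
      \<comment> \<open>Instance with \<open>n = card P\<close>, \<open>j = i - 1\<close> and
        \<open>m = OPT P infl D i\<close>; \<open>card_ge_OPT\<close> starts the invariant.\<close>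
      unfolding mem_Collect_eq using assms i \<sigma> card_ge_OPT[of P i infl D]
      by (intro plackett_luce_utility) auto
    finally show ?thesis unfolding \<sigma>' by simp
  qed
  ultimately show ?thesis using valid unfolding M by blast
qed

end
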